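(* As formal power series in $x$, $$\sum_{n\geq 0}|AI_{2n+1}(4123,2341)|\,x^{2n+1}=\sum_{n\geq 0}|RAI_{2n+1}(4123,2341)|\,x^{2n+1}=\frac{x^5-x^3+x}{1-2x^2-x^6},$$ $$\sum_{n\geq 0}|RAI_{2n}(4123,2341)|\,x^{2n}=\frac{1-x^2}{1-2x^2-x^6},$$ and $$\sum_{n\geq 0}|AI_{2n}(4123,2341)|\,x^{2n}=1+\frac{x^4}{1-x^2}+\frac{(x^5-x^3+x)^2}{(1-2x^2-x^6)(1-x^2)}.$$
   Context: Let $S_n$ be the set of permutations $\pi=\pi_1\ldots\pi_n$ of $\{1,\ldots,n\}$ (for $n=0$, only the empty permutation, which is counted in all classes). A permutation is alternating if, for all $1\le i\le n-1$, $\pi_i<\pi_{i+1}$ if and only if $i$ is odd; it is reverse alternating if, for all $1\le i\le n-1$, $\pi_i>\pi_{i+1}$ if and only if $i$ is odd. $AI_n$ (resp. $RAI_n$) is the set of alternating (resp. reverse alternating) involutions ($\pi=\pi^{-1}$) in $S_n$. A permutation $\pi\in S_n$ avoids the pattern $\tau\in S_k$ if there are no indices $i_1<\cdots<i_k$ such that $\pi_{i_1}\ldots\pi_{i_k}$ is order-isomorphic to $\tau$; $AI_n(\sigma,\tau)$ and $RAI_n(\sigma,\tau)$ are the subsets of elements avoiding both $\sigma$ and $\tau$. (Since $4123=2341^{-1}$, an involution avoids both patterns if and only if it avoids either one.) *)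

theory Defs
  imports
    "HOL-Combinatorics.Permutations"
    "HOL-Computational_Algebra.Formal_Power_Series"
begin

(* An element of S_n is a function p with p permutes {1..n}; thus p i is the
   i-th letter of the word, and p is the identity outside {1..n}. *)

definition alternating :: "nat \<Rightarrow> (nat \<Rightarrow> nat) \<Rightarrow> bool" where
  "alternating n p \<longleftrightarrow> (\<forall>i\<in>{1..<n}. p i < p (i + 1) \<longleftrightarrow> odd i)"

definition reverse_alternating :: "nat \<Rightarrow> (nat \<Rightarrow> nat) \<Rightarrow> bool" where
  "reverse_alternating n p \<longleftrightarrow> (\<forall>i\<in>{1..<n}. p i > p (i + 1) \<longleftrightarrow> odd i)"

(* A pattern t is given by the list of its letters. List positions start at 0,
   so the index sequence is i 0 < ... < i (length t - 1), with values in {1..n}. *)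

definition avoids :: "nat \<Rightarrow> (nat \<Rightarrow> nat) \<Rightarrow> nat list \<Rightarrow> bool" where
  "avoids n p t \<longleftrightarrow>
     \<not> (\<exists>i :: nat \<Rightarrow> nat.
          strict_mono_on {..<length t} i \<and> i ` {..<length t} \<subseteq> {1..n} \<and>
          (\<forall>a<length t. \<forall>b<length t. p (i a) < p (i b) \<longleftrightarrow> t ! a < t ! b))"

definition AI :: "nat \<Rightarrow> (nat \<Rightarrow> nat) set" where
  "AI n = {p. p permutes {1..n} \<and> p = inv p \<and> alternating n p}"

definition RAI :: "nat \<Rightarrow> (nat \<Rightarrow> nat) set" where
  "RAI n = {p. p permutes {1..n} \<and> p = inv p \<and> reverse_alternating n p}"

definition AI_avoiding :: "nat \<Rightarrow> nat list \<Rightarrow> nat list \<Rightarrow> (nat \<Rightarrow> nat) set" where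
  "AI_avoiding n s t = {p \<in> AI n. avoids n p s \<and> avoids n p t}"

definition RAI_avoiding :: "nat \<Rightarrow> nat list \<Rightarrow> nat list \<Rightarrow> (nat \<Rightarrow> nat) set" where
  "RAI_avoiding n s t = {p \<in> RAI n. avoids n p s \<and> avoids n p t}"

end

theory Submission
  imports Defs
begin

text \<open>An involution avoiding 2341 also avoids 4123. Split such an involution as a direct sum at its
  last component: the last component of an alternating or reverse alternating involution is again
  reverse alternating, so everything reduces to the indecomposable involutions. If \<open>p\<close> is
  indecomposable of size at least 2, then \<open>p n < p 1\<close>, since otherwise three consecutive
  overlapping 2-cycles would form a 2341. Avoidance forbids increasing triples before position
  \<open>p 1\<close> and after position \<open>p n\<close>, which nearly pins down \<open>p 1\<close> and \<open>p n\<close> by parity and leaves no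
  increasing triple off the 2-cycle of \<open>1\<close>. There the peaks and the valleys form two decreasing
  sequences, each preserved by \<open>p\<close>, so \<open>p\<close> is determined by \<open>p 1\<close>, and each size and type has
  at most two indecomposables.\<close>

unbundle fps_syntax

section \<open>Pattern avoidance\<close>

text \<open>Positions range over all naturals: outside \<open>{1..n}\<close> a permutation is the
  identity and takes part in no inversion, so no occurrence reaches there. Without a bound the
  condition passes easily to shifted words.\<close>

definition no_2341 :: "(nat \<Rightarrow> nat) \<Rightarrow> bool" where
  "no_2341 p \<longleftrightarrow>
     (\<forall>a b c d. a < b \<and> b < c \<and> c < d \<longrightarrow> \<not> (p d < p a \<and> p a < p b \<and> p b < p c))"

lemma no_2341D:
  "no_2341 p \<Longrightarrow> a < b \<Longrightarrow> b < c \<Longrightarrow> c < d \<Longrightarrow> p d < p a \<Longrightarrow> p a < p b \<Longrightarrow> p b < p c \<Longrightarrow> False"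
  by (auto simp: no_2341_def)

lemma inversion_range:
  fixes p :: "nat \<Rightarrow> nat"
  assumes p: "p permutes {1..n}" and "a < d" "p d < p a"
  shows "a \<ge> 1" "d \<le> n"
proof -
  have out: "p x = x" if "x = 0 \<or> x > n" for x
    using permutes_not_in[OF p, of x] that by auto
  show "a \<ge> 1" using out[of 0] assms(3) by (cases "a = 0") simp_all
  show "d \<le> n"
  proof (rule ccontr)
    assume "\<not> d \<le> n"
    then have "p a > d" "d > n" using out[of d] assms(3) by auto
    then show False
      using permutes_in_image[OF p, of a] out[of a] \<open>a < d\<close> by fastforce
  qed
qed

lemma avoids_2341_iff:
  assumes p: "p permutes {1..n}"
  shows "avoids n p [2,3,4,1] \<longleftrightarrow> no_2341 p"
proof
  assume av: "avoids n p [2,3,4,1]"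
  show "no_2341 p"
    unfolding no_2341_def
  proof (intro allI impI notI, elim conjE)
    fix a b c d assume lt: "a < b" "b < c" "c < d" and v: "p d < p a" "p a < p b" "p b < p c"
    have r: "a \<ge> 1" "d \<le> n"
      using inversion_range[OF p, of a d] lt v(1) by auto
    define i where "i = (\<lambda>j. [a,b,c,d] ! j)"
    have "strict_mono_on {..<length [2,3,4,1::nat]} i"
    proof (rule strict_mono_onI)
      fix r s assume "r \<in> {..<length [2,3,4,1::nat]}" "s \<in> {..<length [2,3,4,1::nat]}" "r < s"
      then show "i r < i s" using lt
        by (auto simp: i_def nth_Cons numeral_eq_Suc less_Suc_eq split: nat.splits)
    qed
    moreover have "i ` {..<length [2,3,4,1::nat]} \<subseteq> {1..n}"
      using r lt by (auto simp: i_def nth_Cons numeral_eq_Suc less_Suc_eq split: nat.splits)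
    moreover have "\<forall>r<length [2,3,4,1::nat]. \<forall>s<length [2,3,4,1::nat].
        p (i r) < p (i s) \<longleftrightarrow> [2,3,4,1::nat] ! r < [2,3,4,1] ! s"
      using v by (simp add: i_def All_less_Suc)
    ultimately show False using av unfolding avoids_def by blast
  qed
next
  assume no: "no_2341 p"
  show "avoids n p [2,3,4,1]"
    unfolding avoids_def
  proof (intro notI, elim exE conjE)
    fix i :: "nat \<Rightarrow> nat"
    assume m: "strict_mono_on {..<length [2,3,4,1::nat]} i"
      and v: "\<forall>a<length [2,3,4,1::nat]. \<forall>b<length [2,3,4,1::nat].
          p (i a) < p (i b) \<longleftrightarrow> [2,3,4,1::nat] ! a < [2,3,4,1] ! b"
    have "i 0 < i 1" "i 1 < i 2" "i 2 < i 3"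
      by (auto intro!: strict_mono_onD[OF m])
    moreover have "p (i 3) < p (i 0)" "p (i 0) < p (i 1)" "p (i 1) < p (i 2)"
      using v by (simp_all add: All_less_Suc numeral_eq_Suc)
    ultimately show False using no_2341D[OF no] by blast
  qed
qed

text \<open>Reflection in the diagonal: the letters of an occurrence of 4123, taken as positions,
  form an occurrence of 2341, because \<open>p\<close> is its own inverse.\<close>

lemma avoids_4123:
  assumes inv: "\<And>i. p (p i) = i" and no: "no_2341 p"
  shows "avoids n p [4,1,2,3]"
  unfolding avoids_def
proof (intro notI, elim exE conjE)
  fix i :: "nat \<Rightarrow> nat"
  assume m: "strict_mono_on {..<length [4,1,2,3::nat]} i"
    and v: "\<forall>a<length [4,1,2,3::nat]. \<forall>b<length [4,1,2,3::nat].
        p (i a) < p (i b) \<longleftrightarrow> [4,1,2,3::nat] ! a < [4,1,2,3] ! b"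
  have "i 0 < i 1" "i 1 < i 2" "i 2 < i 3"
    by (auto intro!: strict_mono_onD[OF m])
  moreover have "p (i 3) < p (i 0)" "p (i 2) < p (i 3)" "p (i 1) < p (i 2)"
    using v by (simp_all add: All_less_Suc numeral_eq_Suc)
  ultimately show False
    using no_2341D[OF no, of "p (i 1)" "p (i 2)" "p (i 3)" "p (i 0)"] by (simp add: inv)
qed

text \<open>The flag \<open>s\<close> fixes the parity of the descents: \<open>True\<close> is
  reverse alternating, \<open>False\<close> is alternating. With a flag, both types are cut into
  components by the same lemmas.\<close>

definition zigzag :: "bool \<Rightarrow> nat \<Rightarrow> (nat \<Rightarrow> nat) set" where
  "zigzag s n = {p. p permutes {1..n} \<and> (\<forall>i. p (p i) = i) \<and> no_2341 p \<and>
     (\<forall>i\<in>{1..<n}. p (i + 1) < p i \<longleftrightarrow> (odd i \<longleftrightarrow> s))}"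

lemma involution_iff:
  assumes "p permutes S"
  shows "p = inv p \<longleftrightarrow> (\<forall>i. p (p i) = i)"
proof
  assume eq: "p = inv p"
  have "inv p (p i) = i" for i
    using permutes_inverses(2)[OF assms] .
  then show "\<forall>i. p (p i) = i" using eq by metis
next
  assume "\<forall>i. p (p i) = i"
  then show "p = inv p"
    using permutes_bij[OF assms] by (metis bij_is_inj inv_f_f ext)
qed

lemma AI_avoiding_eq_zigzag: "AI_avoiding n [4,1,2,3] [2,3,4,1] = zigzag False n"
proof -
  \<comment> \<open>Alternation is phrased by ascents and \<open>zigzag\<close> by descents;
    injectivity rules out equal neighbours.\<close>
  have "p i < p (i + 1) \<longleftrightarrow> \<not> p (i + 1) < p i"
    if "p permutes {1..n}" for p :: "nat \<Rightarrow> nat" and i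
    using permutes_inj[OF that]
    by (metis add_eq_self_zero injD linorder_less_linear zero_neq_one order_less_asym)
  then show ?thesis
    unfolding AI_avoiding_def AI_def zigzag_def alternating_def set_eq_iff mem_Collect_eq
    using avoids_2341_iff avoids_4123 involution_iff by (metis (no_types, lifting))
qed

lemma RAI_avoiding_eq_zigzag: "RAI_avoiding n [4,1,2,3] [2,3,4,1] = zigzag True n"
  unfolding RAI_avoiding_def RAI_def zigzag_def reverse_alternating_def set_eq_iff mem_Collect_eq
  using avoids_2341_iff avoids_4123 involution_iff by (metis (no_types, lifting))

lemma finite_zigzag [simp]: "finite (zigzag s n)"
  by (rule finite_subset[OF _ finite_permutations[of "{1..n}"]]) (auto simp: zigzag_def)

lemma zigzagD:
  assumes "p \<in> zigzag s n"
  shows "p permutes {1..n}" "p (p i) = i" "no_2341 p" "inj p"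
    "i \<in> {1..<n} \<Longrightarrow> p (Suc i) < p i \<longleftrightarrow> (odd i \<longleftrightarrow> s)"
    "p i \<in> {1..n} \<longleftrightarrow> i \<in> {1..n}" "i \<notin> {1..n} \<Longrightarrow> p i = i"
  using assms permutes_inj[of p] permutes_in_image[of p "{1..n}" i] permutes_not_in[of p "{1..n}" i]
  by (auto simp: zigzag_def)

section \<open>Direct sums\<close>

text \<open>Equivalently, no proper nonempty prefix \<open>{1..c}\<close> is mapped to itself. The
  empty permutation satisfies this vacuously.\<close>

definition indecomposable :: "bool \<Rightarrow> nat \<Rightarrow> (nat \<Rightarrow> nat) set" where
  "indecomposable s n = {p \<in> zigzag s n. \<forall>c\<in>{1..<n}. \<exists>i\<in>{1..c}. c < p i}"

text \<open>The size of the second summand need not be given, since \<open>q\<close> is the identity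
  beyond it.\<close>

definition dsum :: "nat \<Rightarrow> (nat \<Rightarrow> nat) \<Rightarrow> (nat \<Rightarrow> nat) \<Rightarrow> nat \<Rightarrow> nat" where
  "dsum c p q = (\<lambda>i. if i \<le> c then p i else q (i - c) + c)"

lemma indecomposableD:
  assumes "p \<in> indecomposable s n"
  shows "p \<in> zigzag s n" "c \<in> {1..<n} \<Longrightarrow> \<exists>i\<in>{1..c}. c < p i"
  using assms unfolding indecomposable_def by blast+

lemma involution_permutes:
  assumes "\<And>i. p (p i) = i" "\<And>i. i \<notin> S \<Longrightarrow> p i = i"
  shows "p permutes S"
proof -
  have "\<exists>!x. p x = y" for y
    by (rule ex1I[of _ "p y"]) (use assms(1) in auto)
  then show ?thesis using assms(2) by (simp add: permutes_def)
qed

lemma zigzagI: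
  assumes "\<And>i. p (p i) = i" "\<And>i. i \<notin> {1..n} \<Longrightarrow> p i = i" "no_2341 p"
    "\<And>i. i \<in> {1..<n} \<Longrightarrow> p (Suc i) < p i \<longleftrightarrow> (odd i \<longleftrightarrow> s)"
  shows "p \<in> zigzag s n"
proof -
  have "p permutes {1..n}"
    by (rule involution_permutes) (use assms(1,2) in auto)
  then show ?thesis using assms by (simp add: zigzag_def)
qed

lemma zigzag_le_iff:
  assumes "p \<in> zigzag s n"
  shows "p i \<le> n \<longleftrightarrow> i \<le> n"
  using zigzagD(6,7)[OF assms, of i] zigzagD(2)[OF assms, of i]
  by (cases "i = 0") auto

lemma zigzag_0:
  assumes "p \<in> zigzag s n"
  shows "p 0 = 0" "p i = 0 \<longleftrightarrow> i = 0"
  using zigzagD(7)[OF assms, of 0] zigzagD(2)[OF assms, of i] by auto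

text \<open>The word rises across the cut, so \<open>c\<close> has to be an ascent position: this is
  \<open>even c \<longleftrightarrow> s\<close>. Counted from \<open>c\<close>, the descents then
  start at once, so the second summand is reverse alternating for either \<open>s\<close>. An
  occurrence of 2341 cannot straddle the cut, since its last letter is below its first.\<close>

lemma dsum_in_zigzag:
  assumes p: "p \<in> zigzag s c" and q: "q \<in> zigzag True d" and s: "even c \<longleftrightarrow> s"
  shows "dsum c p q \<in> zigzag s (c + d)"
proof (rule zigzagI)
  note pD = zigzagD[OF p] and qD = zigzagD[OF q]
  have p_le: "p i \<le> c \<longleftrightarrow> i \<le> c" for i
    using zigzag_le_iff[OF p] .
  have q0: "q i = 0 \<longleftrightarrow> i = 0" for i
    using zigzag_0(2)[OF q] .
  show "dsum c p q (dsum c p q i) = i" for i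
    using p_le[of i] pD(2) qD(2) q0[of "i - c"] by (auto simp: dsum_def)
  show "dsum c p q i = i" if "i \<notin> {1..c + d}" for i
  proof (cases "i = 0")
    case False
    then have "i - c \<notin> {1..d}" "i > c" using that by auto
    then show ?thesis using qD(7)[of "i - c"] by (simp add: dsum_def)
  qed (use pD(7)[of 0] in \<open>simp add: dsum_def\<close>)
  show "no_2341 (dsum c p q)"
    unfolding no_2341_def
  proof (intro allI impI notI, elim conjE)
    fix i j k l assume lt: "i < j" "j < k" "k < l"
      and v: "dsum c p q l < dsum c p q i" "dsum c p q i < dsum c p q j"
        "dsum c p q j < dsum c p q k"
    consider "l \<le> c" | "c < i" | "i \<le> c" "c < l" by linarith
    then show False
    proof cases
      case 1
      then show False using lt v no_2341D[OF pD(3), of i j k l] by (simp add: dsum_def)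
    next
      case 2
      then show False
        using lt v no_2341D[OF qD(3), of "i - c" "j - c" "k - c" "l - c"]
        by (simp add: dsum_def diff_less_mono)
    next
      case 3
      then show False using v(1) p_le[of i] by (simp add: dsum_def)
    qed
  qed
  show "dsum c p q (Suc i) < dsum c p q i \<longleftrightarrow> (odd i \<longleftrightarrow> s)" if i: "i \<in> {1..<c + d}" for i
  proof -
    consider "i < c" | "i = c" | "c < i" by linarith
    then show ?thesis
    proof cases
      case 1
      then show ?thesis using i pD(5)[of i] by (simp add: dsum_def)
    next
      case 2
      then show ?thesis using i p_le[of i] s q0[of 1] by (auto simp: dsum_def)
    next
      case 3
      then have "Suc i - c = Suc (i - c)" by simp
      moreover have "odd (i - c) \<longleftrightarrow> (odd i \<longleftrightarrow> s)" using 3 s by auto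
      moreover have "i - c \<in> {1..<d}" using i 3 by auto
      ultimately show ?thesis using 3 qD(5)[of "i - c"] by (auto simp: dsum_def)
    qed
  qed
qed

lemma closed_prefixD:
  assumes p: "p \<in> zigzag s n" and c: "c \<in> {1..<n}" and cl: "\<And>i. i \<in> {1..c} \<Longrightarrow> p i \<le> c"
  shows "even c \<longleftrightarrow> s"
    and "(\<lambda>i. if i \<le> c then p i else i) \<in> zigzag s c"
    and "(\<lambda>i. p (i + c) - c) \<in> zigzag True (n - c)"
    and "p = dsum c (\<lambda>i. if i \<le> c then p i else i) (\<lambda>i. p (i + c) - c)"
proof -
  note pD = zigzagD[OF p]
  \<comment> \<open>For an involution a closed prefix has a closed complement.\<close>
  have le: "p i \<le> c \<longleftrightarrow> i \<le> c" for i
  proof -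
    have "p i \<le> c" if "i \<le> c" for i
      using that cl[of i] zigzag_0(1)[OF p] by (cases "i = 0") auto
    from this[of i] this[of "p i"] show ?thesis by (auto simp: pD(2))
  qed
  \<comment> \<open>The rise across the cut determines the parity of \<open>c\<close>.\<close>
  have "\<not> p (Suc c) < p c" using le[of c] le[of "Suc c"] by simp
  then show s: "even c \<longleftrightarrow> s" using pD(5)[OF c] by auto
  show "(\<lambda>i. if i \<le> c then p i else i) \<in> zigzag s c"
  proof (rule zigzagI)
    show "no_2341 (\<lambda>i. if i \<le> c then p i else i)"
      unfolding no_2341_def
    proof (intro allI impI notI, elim conjE)
      fix i j k l assume lt: "i < j" "j < k" "k < l"
      and v: "(if l \<le> c then p l else l) < (if i \<le> c then p i else i)"
        "(if i \<le> c then p i else i) < (if j \<le> c then p j else j)"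
        "(if j \<le> c then p j else j) < (if k \<le> c then p k else k)"
      have "l \<le> c"
        using v(1) lt le[of i] by (auto split: if_splits)
      then show False using lt v no_2341D[OF pD(3), of i j k l] by simp
    qed
  qed (use le pD(2,5,7) c zigzag_0(1)[OF p] in auto)
  show "(\<lambda>i. p (i + c) - c) \<in> zigzag True (n - c)"
  proof (rule zigzagI)
    have ge: "c < p (i + c)" if "i > 0" for i
      using le[of "i + c"] that by simp
    \<comment> \<open>At index 0 the shifted word reads \<open>p c - c\<close>, which truncated
      subtraction makes 0, so 0 is a fixed point as required.\<close>
    have z: "p c - c = 0" using le[of c] by simp
    show "p (p (i + c) - c + c) - c = i" for i
      using ge[of i] z by (cases "i = 0") (simp_all add: pD(2))
    show "p (i + c) - c = i" if "i \<notin> {1..n - c}" for i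
      using that pD(7)[of "i + c"] le[of c] by (cases "i = 0") auto
    show "no_2341 (\<lambda>i. p (i + c) - c)"
      unfolding no_2341_def
    proof (intro allI impI notI, elim conjE)
      fix i j k l assume "i < j" "j < k" "k < l"
      and "p (l + c) - c < p (i + c) - c" "p (i + c) - c < p (j + c) - c"
        "p (j + c) - c < p (k + c) - c"
      moreover from this have "p (l + c) < p (i + c)" "p (i + c) < p (j + c)" "p (j + c) < p (k + c)"
        by linarith+
      ultimately show False
        using no_2341D[OF pD(3), of "i + c" "j + c" "k + c" "l + c"] by simp
    qed
    show "p (Suc i + c) - c < p (i + c) - c \<longleftrightarrow> (odd i \<longleftrightarrow> True)" if i: "i \<in> {1..<n - c}" for i
    proof -
      have "i + c \<in> {1..<n}" using i by auto
      then have "p (Suc i + c) < p (i + c) \<longleftrightarrow> odd i" using pD(5)[of "i + c"] s by auto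
      then show ?thesis using ge[of i] ge[of "Suc i"] i by auto
    qed
  qed
  show "p = dsum c (\<lambda>i. if i \<le> c then p i else i) (\<lambda>i. p (i + c) - c)"
  proof
    show "p i = dsum c (\<lambda>i. if i \<le> c then p i else i) (\<lambda>i. p (i + c) - c) i" for i
      using le[of i] by (auto simp: dsum_def)
  qed
qed

text \<open>Cut at the largest closed prefix \<open>c\<close>. A closed prefix of length
  \<open>d\<close> in the remainder would give the larger closed prefix \<open>c + d\<close>, so the
  remainder is indecomposable.\<close>

lemma zigzag_decompose:
  "zigzag s n = indecomposable s n \<union>
     (\<lambda>(c, p, q). dsum c p q) `
       (SIGMA c:{c\<in>{1..<n}. even c \<longleftrightarrow> s}. zigzag s c \<times> indecomposable True (n - c))"
    (is "_ = _ \<union> ?f ` ?S")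
proof (intro equalityI subsetI)
  fix p assume p: "p \<in> zigzag s n"
  show "p \<in> indecomposable s n \<union> ?f ` ?S"
  proof (cases "p \<in> indecomposable s n")
    case False
    define C where "C = {c \<in> {1..<n}. \<forall>i\<in>{1..c}. p i \<le> c}"
    have "C \<noteq> {}" using False p by (fastforce simp: indecomposable_def C_def not_less)
    moreover have "finite C" by (simp add: C_def)
    ultimately have M: "Max C \<in> C" and Mx: "\<And>c. c \<in> C \<Longrightarrow> c \<le> Max C" by auto
    define c where "c = Max C"
    have c: "c \<in> {1..<n}" and cl: "\<And>i. i \<in> {1..c} \<Longrightarrow> p i \<le> c"
      using M unfolding c_def[symmetric] by (auto simp: C_def)
    note D = closed_prefixD[OF p c cl]
    have "\<exists>i\<in>{1..d}. d < p (i + c) - c" if d: "d \<in> {1..<n - c}" for d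
    proof (rule ccontr)
      assume "\<not> (\<exists>i\<in>{1..d}. d < p (i + c) - c)"
      then have "p (i + c) - c \<le> d" if "i \<in> {1..d}" for i using that by (meson not_le)
      then have le: "p (i + c) \<le> c + d" if "i \<in> {1..d}" for i
        using that by fastforce
      have "p i \<le> c + d" if "i \<in> {1..c + d}" for i
      proof (cases "i \<le> c")
        case False
        then have "i - c \<in> {1..d}" using that by auto
        from le[OF this] show ?thesis using False by simp
      qed (use cl[of i] that in auto)
      then have "c + d \<in> C" using c d by (auto simp: C_def)
      then show False using Mx[of "c + d"] d by (simp add: c_def)
    qed
    then have "(\<lambda>i. p (i + c) - c) \<in> indecomposable True (n - c)"
      using D(3) by (simp add: indecomposable_def)
    then have "(c, (\<lambda>i. if i \<le> c then p i else i), (\<lambda>i. p (i + c) - c)) \<in> ?S"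
      using c D(1,2) by auto
    then have "?f (c, (\<lambda>i. if i \<le> c then p i else i), (\<lambda>i. p (i + c) - c)) \<in> ?f ` ?S"
      by (rule imageI)
    then show ?thesis using D(4) by simp
  qed simp
next
  fix p assume "p \<in> indecomposable s n \<union> ?f ` ?S"
  then show "p \<in> zigzag s n"
  proof
    assume "p \<in> ?f ` ?S"
    then show "p \<in> zigzag s n"
    proof (clarsimp)
      fix c q r assume "c < n" "q \<in> zigzag (even c) c" "r \<in> indecomposable True (n - c)"
      then show "dsum c q r \<in> zigzag (even c) n"
        using dsum_in_zigzag[of q "even c" c r "n - c"] by (simp add: indecomposable_def)
    qed
  qed (simp add: indecomposable_def)
qed

text \<open>If \<open>c < d\<close>, the closed prefix of length \<open>d\<close> would leave a
  closed prefix of length \<open>d - c\<close> in the indecomposable \<open>q\<close>. Used in both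
  directions, this makes the cut unique.\<close>

lemma dsum_eq_le:
  assumes q: "q \<in> indecomposable True (n - c)" and p': "p' \<in> zigzag s d"
    and c: "c \<in> {1..<n}" and d: "d \<in> {1..<n}" and eq: "dsum c p q = dsum d p' q'"
  shows "d \<le> c"
proof (rule ccontr)
  assume "\<not> d \<le> c"
  then have "d - c \<in> {1..<n - c}" using d by auto
  then obtain i where i: "i \<in> {1..d - c}" "d - c < q i"
    using q unfolding indecomposable_def by blast
  have "dsum c p q (i + c) > d" using i by (auto simp: dsum_def)
  moreover have "dsum d p' q' (i + c) \<le> d"
    using i zigzag_le_iff[OF p', of "i + c"] by (auto simp: dsum_def)
  ultimately show False using eq by simp
qed

lemma dsum_inj:
  assumes p: "p \<in> zigzag s c" "p' \<in> zigzag s c" and q: "q \<in> zigzag t d" "q' \<in> zigzag t d"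
    and eq: "dsum c p q = dsum c p' q'"
  shows "p = p'" "q = q'"
proof -
  have eq: "dsum c p q i = dsum c p' q' i" for i using eq by simp
  show "p = p'"
  proof
    show "p i = p' i" for i
      using eq[of i] zigzagD(7)[OF p(1), of i] zigzagD(7)[OF p(2), of i]
      by (cases "i \<le> c") (auto simp: dsum_def)
  qed
  show "q = q'"
  proof
    show "q i = q' i" for i
      using eq[of "i + c"] zigzag_0(1)[OF q(1)] zigzag_0(1)[OF q(2)]
      by (cases "i = 0") (auto simp: dsum_def)
  qed
qed

lemma card_zigzag:
  "card (zigzag s n) = card (indecomposable s n) +
     (\<Sum>c | c \<in> {1..<n} \<and> (even c \<longleftrightarrow> s). card (zigzag s c) * card (indecomposable True (n - c)))"
proof -
  define f :: "nat \<times> (nat \<Rightarrow> nat) \<times> (nat \<Rightarrow> nat) \<Rightarrow> nat \<Rightarrow> nat"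
    where "f = (\<lambda>(c, p, q). dsum c p q)"
  define S where
    "S = (SIGMA c:{c\<in>{1..<n}. even c \<longleftrightarrow> s}. zigzag s c \<times> indecomposable True (n - c))"
  have fin: "finite (indecomposable t m)" for t m
    by (rule finite_subset[OF _ finite_zigzag[of t m]]) (auto simp: indecomposable_def)
  have finS: "finite S" unfolding S_def
    by (intro finite_SigmaI finite_cartesian_product fin) auto
  have "inj_on f S"
  proof (rule inj_onI, clarsimp simp: S_def f_def)
    fix c p q d p' q'
    assume a: "c < n" "p \<in> zigzag (even c) c" "q \<in> indecomposable True (n - c)"
      "d < n" "p' \<in> zigzag (even c) d" "q' \<in> indecomposable True (n - d)"
      "dsum c p q = dsum d p' q'" "Suc 0 \<le> c" "Suc 0 \<le> d" "even d = even c"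
    have "d \<le> c" by (rule dsum_eq_le[OF a(3,5) _ _ a(7)]) (use a in auto)
    moreover have "c \<le> d" by (rule dsum_eq_le[OF a(6,2) _ _ a(7)[symmetric]]) (use a in auto)
    ultimately have "c = d" by simp
    moreover have "p = p' \<and> q = q'"
    proof -
      have "q \<in> zigzag True (n - c)" "q' \<in> zigzag True (n - c)"
        using a(3,6) \<open>c = d\<close> by (simp_all add: indecomposable_def)
      moreover have "p' \<in> zigzag (even c) c" "dsum c p q = dsum c p' q'"
        using a(5,7) \<open>c = d\<close> by simp_all
      ultimately show ?thesis using dsum_inj[OF a(2)] by blast
    qed
    ultimately show "c = d \<and> p = p' \<and> q = q'" by simp
  qed
  then have "card (f ` S) = card S" by (rule card_image)
  \<comment> \<open>A direct sum maps \<open>{1..c}\<close> to itself, so it is never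
    indecomposable.\<close>
  moreover have "indecomposable s n \<inter> f ` S = {}"
  proof (clarsimp simp: disjoint_iff S_def f_def)
    fix c p q assume "dsum c p q \<in> indecomposable (even c) n" "c < n" "Suc 0 \<le> c"
      and p: "p \<in> zigzag (even c) c"
    then obtain i where "i \<in> {1..c}" "c < dsum c p q i"
      using indecomposableD(2)[of "dsum c p q" "even c" n c] by auto
    then show False using zigzag_le_iff[OF p, of i] by (auto simp: dsum_def)
  qed
  ultimately have "card (zigzag s n) = card (indecomposable s n) + card S"
    unfolding zigzag_decompose[of s n] f_def[symmetric] S_def[symmetric]
    by (subst card_Un_disjoint) (simp_all add: fin finS)
  moreover have "card S =
      (\<Sum>c | c \<in> {1..<n} \<and> (even c \<longleftrightarrow> s). card (zigzag s c) * card (indecomposable True (n - c)))"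
    unfolding S_def by (subst card_SigmaI) (auto simp: fin card_cartesian_product)
  ultimately show ?thesis by simp
qed

section \<open>Reverse complements\<close>

text \<open>The half-turn of the graph within the square on \<open>{1..n}\<close>.\<close>

definition revcomp :: "nat \<Rightarrow> (nat \<Rightarrow> nat) \<Rightarrow> nat \<Rightarrow> nat" where
  "revcomp n p i = (if i \<in> {1..n} then n + 1 - p (n + 1 - i) else i)"

text \<open>The half-turn commutes with inversion and carries a descent at \<open>i\<close> to one
  at \<open>n - i\<close>, which for odd \<open>n\<close> has the other parity. It turns 2341 into
  4123, the inverse of 2341, so avoidance by involutions is kept.\<close>

lemma revcomp_in_zigzag:
  assumes p: "p \<in> zigzag s n" and n: "odd n"
  shows "revcomp n p \<in> zigzag (\<not> s) n" "revcomp n (revcomp n p) = p"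
proof -
  note pD = zigzagD[OF p]
  have rng: "p (n + 1 - i) \<in> {1..n}" if "i \<in> {1..n}" for i
    using pD(6)[of "n + 1 - i"] that by auto
  have rc: "revcomp n p i = n + 1 - p (n + 1 - i)" if "i \<in> {1..n}" for i
    using that by (simp only: revcomp_def if_True)
  have out: "revcomp n p i = i" if "i \<notin> {1..n}" for i
    unfolding revcomp_def using that by (rule if_not_P)
  have inv: "revcomp n p (revcomp n p i) = i" for i
  proof (cases "i \<in> {1..n}")
    case True
    have "n + 1 - p (n + 1 - i) \<in> {1..n}" using rng[OF True] by auto
    moreover have "n + 1 - (n + 1 - p (n + 1 - i)) = p (n + 1 - i)" using rng[OF True] by auto
    ultimately show ?thesis using True by (simp add: rc pD(2))
  next
    case False
    show ?thesis by (simp only: out[OF False])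
  qed
  show "revcomp n p \<in> zigzag (\<not> s) n"
  proof (rule zigzagI)
    show "revcomp n p (revcomp n p i) = i" for i by (rule inv)
    show "revcomp n p i = i" if "i \<notin> {1..n}" for i
      using that by (rule out)
    have perm: "revcomp n p permutes {1..n}"
      by (rule involution_permutes) (use inv out in auto)
    show "no_2341 (revcomp n p)"
      unfolding no_2341_def
    proof (intro allI impI notI, elim conjE)
      fix a b c d assume lt: "a < b" "b < c" "c < d"
        and v: "revcomp n p d < revcomp n p a" "revcomp n p a < revcomp n p b"
          "revcomp n p b < revcomp n p c"
      have "a \<ge> 1" "d \<le> n" using inversion_range[OF perm, of a d] lt v(1) by auto
      then have r: "a \<in> {1..n}" "b \<in> {1..n}" "c \<in> {1..n}" "d \<in> {1..n}" using lt by auto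
      note v = v[unfolded r[THEN rc]]
      have "p (n + 1 - c) < p (n + 1 - b)" "p (n + 1 - b) < p (n + 1 - a)"
        "p (n + 1 - a) < p (n + 1 - d)"
        using v by linarith+
      moreover have "n + 1 - d < n + 1 - c" "n + 1 - c < n + 1 - b" "n + 1 - b < n + 1 - a"
        using lt r by auto
      ultimately show False
        using no_2341D[OF pD(3), of "p (n + 1 - c)" "p (n + 1 - b)" "p (n + 1 - a)" "p (n + 1 - d)"]
        by (simp add: pD(2))
    qed
    show "revcomp n p (Suc i) < revcomp n p i \<longleftrightarrow> (odd i \<longleftrightarrow> \<not> s)" if i: "i \<in> {1..<n}" for i
    proof -
      have r: "i \<in> {1..n}" "Suc i \<in> {1..n}" and j: "n - i \<in> {1..<n}" using i by auto
      have "revcomp n p (Suc i) < revcomp n p i \<longleftrightarrow> p (Suc (n - i)) < p (n - i)"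
      proof -
        have e: "n + 1 - i = Suc (n - i)" "n + 1 - Suc i = n - i" using i by auto
        show ?thesis
          unfolding r[THEN rc] e using r[THEN rng, unfolded e] by (auto; linarith)
      qed
      also have "\<dots> \<longleftrightarrow> (odd (n - i) \<longleftrightarrow> s)" using pD(5)[OF j] by simp
      also have "\<dots> \<longleftrightarrow> (odd i \<longleftrightarrow> \<not> s)" using i n by auto
      finally show ?thesis .
    qed
  qed
  show "revcomp n (revcomp n p) = p"
  proof
    show "revcomp n (revcomp n p) i = p i" for i
    proof (cases "i \<in> {1..n}")
      case True
      then have "n + 1 - i \<in> {1..n}" "n + 1 - (n + 1 - i) = i" by auto
      moreover have "p i \<in> {1..n}" using True pD(6) by blast
      ultimately show ?thesis
        using True rc[of "n + 1 - i"] by (auto simp: revcomp_def[of n "revcomp n p"])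
    next
      case False
      then show ?thesis
        unfolding revcomp_def[of n "revcomp n p"] if_not_P[OF False] using pD(7)[of i] by simp
    qed
  qed
qed

lemma card_zigzag_odd:
  assumes "odd n"
  shows "card (zigzag False n) = card (zigzag True n)"
proof (rule bij_betw_same_card)
  show "bij_betw (revcomp n) (zigzag False n) (zigzag True n)"
    by (rule bij_betw_byWitness[where f' = "revcomp n"])
      (use revcomp_in_zigzag[OF _ assms] in fastforce)+
qed

section \<open>Words without increasing triples\<close>

text \<open>If \<open>g x < x\<close>, then \<open>g (g x) < g x\<close>, so a smaller element is
  moved down as well; induction excludes this, and the mirrored argument starts at the
  maximum.\<close>

lemma strict_mono_self_map:
  fixes g :: "nat \<Rightarrow> nat"
  assumes fin: "finite V" and g: "\<And>x. x \<in> V \<Longrightarrow> g x \<in> V"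
    and mono: "\<And>x y. x \<in> V \<Longrightarrow> y \<in> V \<Longrightarrow> x < y \<Longrightarrow> g x < g y" and x: "x \<in> V"
  shows "g x = x"
proof (rule antisym)
  show "x \<le> g x"
    using x
  proof (induction x rule: less_induct)
    case (less x)
    show ?case
    proof (rule ccontr)
      assume "\<not> x \<le> g x"
      then show False
        using less.IH[of "g x"] mono[of "g x" x] g less.prems by fastforce
    qed
  qed
  \<comment> \<open>Downward induction, with \<open>k\<close> bounding the distance from
    \<open>Max V\<close>.\<close>
  have "\<forall>x\<in>V. x \<ge> Max V - k \<longrightarrow> g x \<le> x" for k
  proof (induction k)
    case 0
    then show ?case using Max_ge[OF fin] g by fastforce
  next
    case (Suc k)
    show ?case
    proof (intro ballI impI, rule ccontr)
      fix x assume x: "x \<in> V" "Max V - Suc k \<le> x" "\<not> g x \<le> x"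
      then have "g (g x) \<le> g x" using Suc g[of x] by auto
      moreover have "g x < g (g x)" using x mono g by simp
      ultimately show False by simp
    qed
  qed
  from this[of "Max V"] show "g x \<le> x" using x by simp
qed

text \<open>Being the smaller letter of an increasing pair is a property of points of the graph that
  survives reflection in the diagonal; without increasing triples this makes the smaller
  (\<open>L\<close>) and the larger letters two decreasing sequences that \<open>p\<close> maps to themselves.\<close>

lemma no_123_split:
  fixes p :: "nat \<Rightarrow> nat"
  assumes inv: "\<And>i. p (p i) = i" and X: "\<And>x. x \<in> X \<Longrightarrow> p x \<in> X"
    and no: "\<And>a b c. \<lbrakk>a \<in> X; b \<in> X; c \<in> X; a < b; b < c; p a < p b; p b < p c\<rbrakk> \<Longrightarrow> False"
    and low: "\<And>x. x \<in> X \<Longrightarrow> L x \<Longrightarrow> \<exists>y\<in>X. x < y \<and> p x < p y"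
    and high: "\<And>x. x \<in> X \<Longrightarrow> \<not> L x \<Longrightarrow> \<exists>y\<in>X. y < x \<and> p y < p x"
    and x: "x \<in> X"
  shows "L (p x) \<longleftrightarrow> L x"
    and "y \<in> X \<Longrightarrow> x < y \<Longrightarrow> L x \<longleftrightarrow> L y \<Longrightarrow> p y < p x"
proof -
  have L: "L z \<longleftrightarrow> (\<exists>y\<in>X. z < y \<and> p z < p y)" if "z \<in> X" for z
    using low[OF that] high[OF that] no that by blast
  have L': "L (p z)" if "L z" "z \<in> X" for z
    using that L[of z] L[of "p z"] X inv by metis
  show "L (p x) \<longleftrightarrow> L x" using L'[of x] L'[of "p x"] x X inv by metis
  \<comment> \<open>An increasing pair within one class extends to a triple: \<open>low\<close> adds
    a point after two smaller letters, \<open>high\<close> one before two larger letters.\<close>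
  show "p y < p x" if "y \<in> X" "x < y" "L x \<longleftrightarrow> L y"
  proof (rule ccontr)
    assume "\<not> p y < p x"
    moreover have "p x \<noteq> p y" using inv that(2) by (metis less_irrefl)
    ultimately have "p x < p y" by simp
    then show False using low[of y] high[of x] no that x by blast
  qed
qed

text \<open>On each class of \<open>L\<close> both \<open>p\<close> and \<open>r\<close> are
  decreasing self-maps, so \<open>r\<close> after \<open>p\<close> is increasing on a finite set and
  hence the identity there. As \<open>r\<close> is an involution, \<open>p\<close> equals
  \<open>r\<close>.\<close>

lemma no_123_unique:
  fixes p r :: "nat \<Rightarrow> nat"
  assumes fin: "finite X" and inv: "\<And>i. p (p i) = i" and X: "\<And>x. x \<in> X \<Longrightarrow> p x \<in> X"
    and no: "\<And>a b c. \<lbrakk>a \<in> X; b \<in> X; c \<in> X; a < b; b < c; p a < p b; p b < p c\<rbrakk> \<Longrightarrow> False"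
    and low: "\<And>x. x \<in> X \<Longrightarrow> L x \<Longrightarrow> \<exists>y\<in>X. x < y \<and> p x < p y"
    and high: "\<And>x. x \<in> X \<Longrightarrow> \<not> L x \<Longrightarrow> \<exists>y\<in>X. y < x \<and> p y < p x"
    and r: "\<And>x. x \<in> X \<Longrightarrow> r x \<in> X" "\<And>x. r (r x) = x"
      "\<And>x. x \<in> X \<Longrightarrow> L (r x) \<longleftrightarrow> L x"
      "\<And>x y. x \<in> X \<Longrightarrow> y \<in> X \<Longrightarrow> x < y \<Longrightarrow> L x \<longleftrightarrow> L y \<Longrightarrow> r y < r x"
    and x: "x \<in> X"
  shows "p x = r x"
proof -
  have p1: "L (p y) \<longleftrightarrow> L y" if "y \<in> X" for y
    by (rule no_123_split(1)[of p X L]) (fact assms that)+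
  have p2: "p z < p y" if "y \<in> X" "z \<in> X" "y < z" "L y \<longleftrightarrow> L z" for y z
    by (rule no_123_split(2)[of p X L]) (fact assms that)+
  define V where "V = {y \<in> X. L y \<longleftrightarrow> L x}"
  have pV: "p y \<in> V" if "y \<in> V" for y
    using that p1[of y] X[of y] by (auto simp: V_def)
  have rV: "r y \<in> V" if "y \<in> V" for y
    using that r(1,3)[of y] by (auto simp: V_def)
  have "r (p x) = x"
  proof (rule strict_mono_self_map)
    show "finite V" "x \<in> V" using fin x by (auto simp: V_def)
    show "r (p y) \<in> V" if "y \<in> V" for y
      using that pV rV by blast
    show "r (p y) < r (p z)" if "y \<in> V" "z \<in> V" "y < z" for y z
    proof -
      have "p z < p y" using p2[of y z] that by (auto simp: V_def)
      then show ?thesis using r(4)[of "p z" "p y"] pV that by (auto simp: V_def)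
    qed
  qed
  then show ?thesis using r(2)[of "p x"] by simp
qed

section \<open>Indecomposable involutions\<close>

text \<open>Suppose \<open>p 1 < p n\<close>. Let \<open>M\<close> be the largest letter up to
  position \<open>p 1\<close>, at position \<open>a\<close>; it exceeds \<open>p 1\<close> by
  indecomposability, and \<open>M = n\<close> would give \<open>p n = a \<le> p 1\<close>. Some
  \<open>b\<close> in \<open>{1..M}\<close> then has \<open>p b > M\<close>, and positions 1,
  \<open>a\<close>, \<open>b\<close>, \<open>M\<close> carry 2341.\<close>

lemma indecomposable_ends:
  assumes p: "p \<in> indecomposable s n" and n: "n \<ge> 2"
  shows "p n < p 1"
proof (rule ccontr)
  note z = indecomposableD(1)[OF p]
  note pD = zigzagD[OF z]
  assume "\<not> p n < p 1"
  moreover have "p n \<noteq> p 1" using n pD(4) by (simp add: inj_eq)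
  ultimately have lt: "p 1 < p n" by simp
  have le: "p i \<le> n \<longleftrightarrow> i \<le> n" for i
    by (rule zigzag_le_iff[OF z])
  have "p 1 > 1" using indecomposableD(2)[OF p, of 1] n by auto
  moreover have "p n \<le> n" using le by simp
  ultimately have k: "p 1 \<in> {1..<n}" using lt by auto
  define M where "M = Max (p ` {1..p 1})"
  have M_ge: "p i \<le> M" if "i \<in> {1..p 1}" for i
    unfolding M_def using that by simp
  have "M \<in> p ` {1..p 1}" unfolding M_def using k by (intro Max_in) auto
  then obtain a where a: "a \<in> {1..p 1}" "p a = M" by auto
  obtain i where "i \<in> {1..p 1}" "p 1 < p i" using indecomposableD(2)[OF p k] by auto
  then have Mk: "p 1 < M" using M_ge[of i] by simp
  have pM: "p M = a" using a pD(2) by auto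
  have "M \<le> n" using a k le[of a] by auto
  moreover have "M \<noteq> n" using pM a lt by auto
  ultimately have "M \<in> {1..<n}" using Mk by auto
  then obtain b where b: "b \<in> {1..M}" "M < p b" using indecomposableD(2)[OF p] by blast
  have "\<not> b \<le> p 1" using b M_ge[of b] by auto
  moreover have "b \<noteq> M" using pM b a Mk by auto
  moreover have "a \<noteq> 1" "a \<noteq> p 1" using a(2) Mk pD(2)[of 1] k by auto
  ultimately show False
    using no_2341D[OF pD(3), of 1 a b M] a b pM Mk by auto
qed

text \<open>The letter 1 stands at position \<open>p 1\<close>, so an increasing triple before it
  completes to 2341. The second claim is the reflected case: positions \<open>p a\<close>,
  \<open>p b\<close>, \<open>p c\<close>, \<open>n\<close> carry the letters \<open>a\<close>,
  \<open>b\<close>, \<open>c\<close>, \<open>p n\<close>.\<close>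

lemma indecomposable_no_123:
  assumes p: "p \<in> zigzag s n" and r: "a \<in> {1..n}" "b \<in> {1..n}" "c \<in> {1..n}"
    and lt: "a < b" "b < c" "p a < p b" "p b < p c" and n: "n \<ge> 1"
  shows "\<not> c < p 1" "\<not> p n < a"
proof -
  note pD = zigzagD[OF p]
  show "\<not> c < p 1"
  proof
    assume c: "c < p 1"
    then have "p a \<noteq> 1" using pD(2)[of a] lt by auto
    moreover have "p a \<ge> 1" using pD(6)[of a] r by simp
    ultimately show False
      using no_2341D[OF pD(3), of a b c "p 1"] c lt by (simp add: pD(2))
  qed
  show "\<not> p n < a"
  proof
    assume c: "p n < a"
    then have "p c \<noteq> n" using pD(2)[of c] lt by auto
    moreover have "p c \<le> n" using pD(6)[of c] r by simp
    ultimately show False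
      using no_2341D[OF pD(3), of "p a" "p b" "p c" n] c lt by (simp add: pD(2))
  qed
qed

text \<open>The indecomposable reverse alternating involutions: besides two transpositions (which
  coincide if \<open>k = n\<close>), the even and the odd positions are reversed separately.\<close>

definition rev_zig :: "nat \<Rightarrow> nat \<Rightarrow> nat \<Rightarrow> nat \<Rightarrow> nat" where
  "rev_zig n k m x =
     (if x = 0 \<or> n < x then x else if x = 1 then k else if x = k then 1
      else if x = m then n else if x = n then m
      else if even x then k - x else 2 * (n div 2) + m + 1 - x)"

text \<open>\<open>k\<close> is the first letter and \<open>m\<close> the last. The lower bounds on
  \<open>n\<close> are exactly what \<open>m < k\<close> demands in each family.\<close>

definition rev_zig_params :: "nat \<Rightarrow> nat \<Rightarrow> nat \<Rightarrow> bool" where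
  "rev_zig_params n k m \<longleftrightarrow>
     even n \<and> 2 \<le> n \<and> k = n \<and> m = 1 \<or> even n \<and> 6 \<le> n \<and> k = n - 2 \<and> m = 3 \<or>
     odd n \<and> 5 \<le> n \<and> k = n - 1 \<and> m = 3"

text \<open>Meant for even \<open>n\<close>: odd and even positions are reversed separately,
  exchanging 1 with \<open>n - 1\<close> and 2 with \<open>n\<close>. For \<open>n = 4\<close> the
  word is 3412.\<close>

definition zig :: "nat \<Rightarrow> nat \<Rightarrow> nat" where
  "zig n x = (if x = 0 \<or> n < x then x else if odd x then n - x else n + 2 - x)"

lemma rev_zig_params_cases:
  assumes "rev_zig_params n k m"
  obtains (outer) h where "n = 2 * h" "k = 2 * h" "m = 1" "1 \<le> h"
    | (even) h where "n = 2 * h + 2" "k = 2 * h" "m = 3" "2 \<le> h"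
    | (odd) h where "n = 2 * h + 1" "k = 2 * h" "m = 3" "2 \<le> h"
  using assms unfolding rev_zig_params_def
proof (elim disjE conjE)
  assume "even n" "2 \<le> n" "k = n" "m = 1"
  then show ?thesis using outer[of "n div 2"] by auto
next
  assume "even n" "6 \<le> n" "k = n - 2" "m = 3"
  then show ?thesis using even[of "n div 2 - 1"] by auto
next
  assume "odd n" "5 \<le> n" "k = n - 1" "m = 3"
  then show ?thesis using odd[of "n div 2"] by auto
qed

lemma parity_cases:
  obtains y where "x = 2 * y" | y where "x = Suc (2 * y)"
  by (cases "even x") (auto elim: evenE oddE)

section \<open>Verification of the explicit words\<close>

lemma rev_zig_ends:
  assumes "rev_zig_params n k m" and f: "f = rev_zig n k m"
  shows "f 1 = k" "f k = 1" "f n = m" "f m = n" "m < k" "k \<in> {1..n}" "1 \<le> m"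
  unfolding f using assms(1)
  by (cases rule: rev_zig_params_cases; simp add: rev_zig_def)+

text \<open>With the argument written as \<open>2 * y\<close> or \<open>Suc (2 * y)\<close>, the
  nested conditions become linear in \<open>y\<close> and \<open>h\<close>, so the later checks are
  plain case distinctions. In the odd family the exchange of 3 and \<open>n\<close> is part of the
  reversal of the odd positions.\<close>

lemma rev_zig_cases:
  assumes "rev_zig_params n k m" and f: "f = rev_zig n k m"
  obtains (outer) h where "n = 2 * h" "k = 2 * h" "m = 1" "1 \<le> h"
      "\<And>y. f (2 * y) = (if y = 0 \<or> h < y then 2 * y else if y = h then 1 else 2 * (h - y))"
      "\<And>y. f (Suc (2 * y)) =
        (if h \<le> y then Suc (2 * y) else if y = 0 then 2 * h else Suc (2 * (h - y)))"
    | (even) h where "n = 2 * h + 2" "k = 2 * h" "m = 3" "2 \<le> h"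
      "\<And>y. f (2 * y) =
        (if y = 0 \<or> h + 1 < y then 2 * y else if y = h then 1 else if y = h + 1 then 3
         else 2 * (h - y))"
      "\<And>y. f (Suc (2 * y)) =
        (if h < y then Suc (2 * y) else if y = 0 then 2 * h else if y = 1 then 2 * h + 2
         else Suc (2 * (h + 2 - y)))"
    | (odd) h where "n = 2 * h + 1" "k = 2 * h" "m = 3" "2 \<le> h"
      "\<And>y. f (2 * y) =
        (if y = 0 \<or> h < y then 2 * y else if y = h then 1 else 2 * (h - y))"
      "\<And>y. f (Suc (2 * y)) =
        (if h < y then Suc (2 * y) else if y = 0 then 2 * h else Suc (2 * (h + 1 - y)))"
  using assms(1)
proof (cases rule: rev_zig_params_cases)
  case (outer h)
  then show ?thesis
    by (intro that(1)[of h]) (auto simp: f rev_zig_def)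
next
  case (even h)
  have "3 = 2 * y \<longleftrightarrow> False" "Suc (2 * y) = 2 * h \<longleftrightarrow> False" for y :: nat
    by presburger+
  with even show ?thesis
    by (intro that(2)[of h]) (auto simp: f rev_zig_def)
next
  case (odd h)
  have "3 = 2 * y \<longleftrightarrow> False" "Suc (2 * y) = 2 * h \<longleftrightarrow> False" for y :: nat
    by presburger+
  with odd show ?thesis
    by (intro that(3)[of h]) (auto simp: f rev_zig_def)
qed

lemma rev_zig_involution:
  assumes "rev_zig_params n k m" and "f = rev_zig n k m"
  shows "f (f x) = x"
  using rev_zig_ends[OF assms]
  by (cases rule: rev_zig_cases[OF assms]; cases x rule: parity_cases) auto

text \<open>The class \<open>even x \<and> x \<noteq> n\<close> consists of the valleys, except that
  an even \<open>n\<close> different from \<open>k\<close> is exchanged with the odd position 3 and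
  therefore goes with the peaks.\<close>

lemma rev_zig_split:
  assumes "rev_zig_params n k m" and "f = rev_zig n k m" and "x \<in> {1..n} - {1, k}"
  shows "f x \<in> {1..n} - {1, k}"
    and "even (f x) \<and> f x \<noteq> n \<longleftrightarrow> even x \<and> x \<noteq> n"
    and "even x \<and> x \<noteq> n \<Longrightarrow> f x < k"
proof -
  show "f x \<in> {1..n} - {1, k}"
    using assms(3)
    by (cases rule: rev_zig_cases[OF assms(1,2)]; cases x rule: parity_cases)
      (auto simp: Suc_double_not_eq_double)
  show "even (f x) \<and> f x \<noteq> n \<longleftrightarrow> even x \<and> x \<noteq> n"
    using assms(3) rev_zig_ends(3)[OF assms(1,2)]
    by (cases rule: rev_zig_cases[OF assms(1,2)]; cases x rule: parity_cases) auto
  show "even x \<and> x \<noteq> n \<Longrightarrow> f x < k"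
    using assms(3)
    by (cases rule: rev_zig_cases[OF assms(1,2)]; cases x rule: parity_cases) auto
qed

lemma rev_zig_antimono:
  assumes "rev_zig_params n k m" and "f = rev_zig n k m"
    and "x \<in> {1..n} - {1, k}" "y \<in> {1..n} - {1, k}" "x < y"
    "even x \<and> x \<noteq> n \<longleftrightarrow> even y \<and> y \<noteq> n"
  shows "f y < f x"
  using assms(3-) rev_zig_ends(3)[OF assms(1,2)]
  by (cases rule: rev_zig_cases[OF assms(1,2)]; cases x rule: parity_cases;
      cases y rule: parity_cases) auto

lemma rev_zig_descents:
  assumes "rev_zig_params n k m" and "f = rev_zig n k m" and "x \<in> {1..<n}"
  shows "f (Suc x) < f x \<longleftrightarrow> odd x"
proof (cases x rule: parity_cases)
  case (1 y)
  then show ?thesis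
    using assms(3) by (cases rule: rev_zig_cases[OF assms(1,2)]) auto
next
  case (2 y)
  then have "f (Suc x) = f (2 * Suc y)" by simp
  moreover have "f x = f (Suc (2 * y))" using 2 by simp
  ultimately show ?thesis
    using assms(3) 2
    by (cases rule: rev_zig_cases[OF assms(1,2)]) (auto simp del: mult_Suc_right)
qed

text \<open>In an occurrence of 2341 none of \<open>a\<close>, \<open>b\<close>, \<open>c\<close> is
  \<open>k\<close>, which carries the letter 1. If \<open>a\<close> is not 1 either, two of the
  three lie in the same decreasing sequence. If \<open>a = 1\<close>, then \<open>b\<close> and
  \<open>c\<close> carry letters above \<open>k\<close>, so neither is in the class of valleys and
  they form a descending pair.\<close>

lemma rev_zig_indecomposable:
  assumes "rev_zig_params n k m"
  shows "rev_zig n k m \<in> indecomposable True n"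
proof -
  define f where "f = rev_zig n k m"
  note ends = rev_zig_ends[OF assms f_def]
  note inv = rev_zig_involution[OF assms f_def]
  note split = rev_zig_split[OF assms f_def]
  note anti = rev_zig_antimono[OF assms f_def]
  have out: "f i = i" if "i \<notin> {1..n}" for i
    unfolding f_def rev_zig_def by (rule if_P) (use that in auto)
  have perm: "f permutes {1..n}"
    by (rule involution_permutes) (use inv out in auto)
  have "f \<in> zigzag True n"
  proof (rule zigzagI)
    show "f (f i) = i" for i by (rule inv)
    show "f i = i" if "i \<notin> {1..n}" for i using that by (rule out)
    show "f (Suc i) < f i \<longleftrightarrow> (odd i \<longleftrightarrow> True)" if "i \<in> {1..<n}" for i
      using rev_zig_descents[OF assms f_def that] by simp
    show "no_2341 f"
      unfolding no_2341_def
    proof (intro allI impI notI, elim conjE)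
      fix a b c d assume lt: "a < b" "b < c" "c < d" and v: "f d < f a" "f a < f b" "f b < f c"
      have r: "a \<ge> 1" "d \<le> n" using inversion_range[OF perm, of a d] lt v(1) by auto
      then have "f d \<ge> 1" using permutes_in_image[OF perm, of d] lt by auto
      then have "a \<noteq> k" "b \<noteq> k" "c \<noteq> k" using v ends(2) by auto
      then have X: "b \<in> {1..n} - {1, k}" "c \<in> {1..n} - {1, k}" "a \<noteq> 1 \<Longrightarrow> a \<in> {1..n} - {1, k}"
        using r lt by auto
      show False
      proof (cases "a = 1")
        case True
        then have "f b > k" "f c > k" using v ends(1) by auto
        then have "odd b \<or> b = n" "odd c \<or> c = n" using split(3)[OF X(1)] split(3)[OF X(2)] by auto
        then show False using anti[OF X(1,2)] lt v by auto
      next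
        case False
        then show False using anti[OF X(1,2)] anti[OF X(3,1)] anti[OF X(3,2)] lt v by fastforce
      qed
    qed
  qed
  \<comment> \<open>The arcs from 1 to \<open>k\<close> and from \<open>m\<close> to
    \<open>n\<close> overlap because \<open>m < k\<close>, so every cut crosses one of them.\<close>
  moreover have "\<exists>i\<in>{1..c}. c < f i" if "c \<in> {1..<n}" for c
  proof (cases "c < k")
    case True
    then show ?thesis using that ends(1) by (intro bexI[of _ 1]) auto
  next
    case False
    then show ?thesis using that ends(4,5,7) by (intro bexI[of _ m]) auto
  qed
  ultimately show ?thesis by (simp add: indecomposable_def f_def)
qed

text \<open>Two decreasing sequences cover all positions, so no increasing triple exists. The cut at
  1 is crossed by the arc from 1 to \<open>n - 1\<close>, later cuts by the arc from 2 to
  \<open>n\<close>.\<close>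

lemma zig_indecomposable:
  assumes n: "even n" "4 \<le> n"
  shows "zig n \<in> indecomposable False n"
proof -
  obtain h where h: "n = 2 * h" "2 \<le> h" using n by (auto elim: evenE)
  define f where "f = zig n"
  have f: "f (2 * y) = (if y = 0 \<or> h < y then 2 * y else 2 * (h + 1 - y))"
    "f (Suc (2 * y)) = (if h \<le> y then Suc (2 * y) else Suc (2 * (h - Suc y)))" for y
    using h by (auto simp: f_def zig_def)
  have inv: "f (f i) = i" for i
    by (cases i rule: parity_cases) (auto simp: f)
  have out: "f i = i" if "i \<notin> {1..n}" for i
    unfolding f_def zig_def by (rule if_P) (use that in auto)
  have anti: "f j < f i" if "i \<in> {1..n}" "j \<in> {1..n}" "i < j" "even i \<longleftrightarrow> even j" for i j
    using that h by (cases i rule: parity_cases; cases j rule: parity_cases) (auto simp: f)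
  have perm: "f permutes {1..n}"
    by (rule involution_permutes) (use inv out in auto)
  have "f \<in> zigzag False n"
  proof (rule zigzagI)
    show "f (f i) = i" for i by (rule inv)
    show "f i = i" if "i \<notin> {1..n}" for i using that by (rule out)
    show "f (Suc i) < f i \<longleftrightarrow> (odd i \<longleftrightarrow> False)" if i: "i \<in> {1..<n}" for i
    proof (cases i rule: parity_cases)
      case (1 y)
      then show ?thesis using i h by (auto simp: f)
    next
      case (2 y)
      then have "f (Suc i) = f (2 * Suc y)" "f i = f (Suc (2 * y))" by simp_all
      then show ?thesis using 2 i h by (auto simp: f simp del: mult_Suc_right)
    qed
    show "no_2341 f"
      unfolding no_2341_def
    proof (intro allI impI notI, elim conjE)
      fix a b c d assume lt: "a < b" "b < c" "c < d" and v: "f d < f a" "f a < f b" "f b < f c"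
      have "a \<ge> 1" "d \<le> n" using inversion_range[OF perm, of a d] lt v(1) by auto
      then have X: "a \<in> {1..n}" "b \<in> {1..n}" "c \<in> {1..n}" using lt by auto
      show False using anti[OF X(1,2)] anti[OF X(2,3)] anti[OF X(1,3)] lt v by fastforce
    qed
  qed
  moreover have "\<exists>i\<in>{1..c}. c < f i" if c: "c \<in> {1..<n}" for c
  proof (cases "c = 1")
    case True
    moreover have "f 1 = n - 1" using h f(2)[of 0] by simp
    ultimately show ?thesis using n by auto
  next
    case False
    moreover have "f 2 = n" using h f(1)[of 1] by simp
    ultimately show ?thesis using c by (intro bexI[of _ 2]) auto
  qed
  ultimately show ?thesis by (simp add: indecomposable_def f_def)
qed

section \<open>Uniqueness of the indecomposable involutions\<close>

text \<open>First \<open>k\<close> and \<open>m\<close> are confined to the listed families. Then,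
  off the positions 1 and \<open>k\<close>, there is no increasing triple, and
  \<open>no_123_unique\<close> compares \<open>p\<close> with \<open>rev_zig\<close>.\<close>

lemma indecomposable_reverse_alternating_eq:
  assumes p: "p \<in> indecomposable True n" and n: "n \<ge> 2"
  obtains k m where "rev_zig_params n k m" "p = rev_zig n k m"
proof -
  note z = indecomposableD(1)[OF p]
  note pD = zigzagD[OF z]
  note no123 = indecomposable_no_123[OF z]
  define k where "k = p 1"
  define m where "m = p n"
  have ends: "p 1 = k" "p k = 1" "p n = m" "p m = n"
    by (simp_all add: k_def m_def pD(2))
  have r: "k \<in> {1..n}" "m \<in> {1..n}"
    using n pD(6)[of 1] pD(6)[of n] by (auto simp: k_def m_def)
  have mk: "m < k" using indecomposable_ends[OF p n] by (simp add: k_def m_def)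
  have rng: "1 \<le> p i" "p i \<le> n" if "1 \<le> i" "i \<le> n" for i
    using that pD(6)[of i] by auto
  have desc: "p (Suc i) < p i" if "odd i" "i < n" for i
    using pD(5)[of i] that by (cases "i = 0") auto
  have asc: "p i < p (Suc i)" if "even i" "1 \<le> i" "i < n" for i
  proof -
    have "p (Suc i) \<noteq> p i" using pD(4) by (simp add: inj_eq)
    then show ?thesis using pD(5)[of i] that by auto
  qed
  have prefix: False if "1 \<le> a" "a < b" "b < c" "c < k" "p a < p b" "p b < p c" for a b c
    using no123(1)[of a b c] that r n by (auto simp: k_def)
  have suffix: False if "m < a" "a < b" "b < c" "c \<le> n" "p a < p b" "p b < p c" for a b c
    using no123(2)[of a b c] that r n by (auto simp: m_def)
  \<comment> \<open>Position \<open>k\<close> holds the letter 1, so it must be a valley; likewise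
    \<open>m\<close> holds \<open>n\<close> and must be a peak.\<close>
  have k: "even k"
  proof (rule ccontr)
    assume k: "odd k"
    show False
    proof (cases "k = n")
      case True
      then have "p (n - 1) < p (Suc (n - 1))" using k n by (intro asc) auto
      moreover have "1 \<le> p (n - 1)" using n by (intro rng(1)) auto
      ultimately show False using ends(2) True n by simp
    next
      case False
      then show False using desc[of k] ends(2) rng(1)[of "Suc k"] k r by auto
    qed
  qed
  have m: "odd m"
  proof
    assume m: "even m"
    then have "1 < m" using r by (cases "m = 1") auto
    moreover from this have "p (Suc (m - 1)) < p (m - 1)" using m r by (intro desc) auto
    moreover have "p (m - 1) \<le> n" using r \<open>1 < m\<close> by (intro rng(2)) auto
    ultimately show False using ends(4) by simp
  qed
  \<comment> \<open>Otherwise positions \<open>k\<close>, \<open>k + 2\<close>, \<open>k + 3\<close>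
    carry an increasing triple that starts with the letter 1 and lies after
    \<open>m\<close>.\<close>
  have k_ge: "n < k + 3"
  proof (rule ccontr)
    assume "\<not> n < k + 3"
    moreover from this have "p (k + 2) \<ge> 1" "p (k + 2) \<noteq> 1" "p (k + 2) < p (Suc (k + 2))"
      using k rng(1)[of "k + 2"] asc[of "k + 2"] pD(2)[of "k + 2"] ends(1) by auto
    ultimately show False using suffix[of k "k + 2" "k + 3"] mk ends(2) by (simp add: numeral_3_eq_3)
  qed
  \<comment> \<open>Otherwise positions \<open>m - 3\<close>, \<open>m - 2\<close>, \<open>m\<close>
    carry an increasing triple that ends with the letter \<open>n\<close> and lies before
    \<open>k\<close>.\<close>
  have m_le: "m \<le> 3"
  proof (rule ccontr)
    assume "\<not> m \<le> 3"
    then have m5: "m > 3" by simp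
    have lt: "1 \<le> m - 3" "m - 3 < m - 2" "m - 2 < m" using m5 by linarith+
    have "p (m - 3) < p (Suc (m - 3))" using m m5 r by (intro asc) auto
    moreover have "Suc (m - 3) = m - 2" using m5 by simp
    moreover have "p (m - 2) \<le> n" using m5 r by (intro rng(2)) auto
    moreover have "p (m - 2) \<noteq> n" using m5 pD(2)[of "m - 2"] ends(3) by auto
    ultimately show False using prefix[OF lt mk] ends(4) by simp
  qed
  have m_eq: "m = (if k = n then 1 else 3)"
  proof (cases "k = n")
    case True
    then show ?thesis using ends by simp
  next
    case False
    then have "m \<noteq> 1" using ends by auto
    then show ?thesis using m m_le r False by (auto simp: le_Suc_eq numeral_3_eq_3)
  qed
  have params: "rev_zig_params n k m"
  proof (cases "k = n")
    case True
    then show ?thesis using m_eq k n by (simp add: rev_zig_params_def)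
  next
    case False
    then have "k = n - 1 \<or> k = n - 2" using k_ge r by auto
    then have "odd n \<and> k = n - 1 \<or> even n \<and> k = n - 2" using k n by auto
    then show ?thesis
      using False m_eq mk by (auto simp: rev_zig_params_def)
  qed
  define f where "f = rev_zig n k m"
  note f_ends = rev_zig_ends[OF params f_def]
  define X where "X = {1..n} - {1, k}"
  have XD: "p x \<noteq> 1" "p x \<noteq> k" "p x \<in> X" "x \<noteq> 1" "x \<noteq> k" "1 \<le> x" "x \<le> n" if "x \<in> X" for x
    using that ends pD(2)[of x] rng[of x] by (auto simp: X_def)
  have p2: "2 \<in> X" if "k \<noteq> n"
    using that m_eq mk n by (auto simp: X_def)
  have p_eq: "p x = f x" if "x \<in> X" for x
  proof (rule no_123_unique[where p = p and r = f and x = x and L = "\<lambda>x. even x \<and> x \<noteq> n" and X = X])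
    show "finite X" "x \<in> X" using that by (auto simp: X_def)
    show "p (p i) = i" for i by (rule pD(2))
    show "p x \<in> X" if "x \<in> X" for x using that by (rule XD)
    show "f x \<in> X" if "x \<in> X" for x
      using rev_zig_split(1)[OF params f_def] that by (simp add: X_def)
    show "f (f x) = x" for x by (rule rev_zig_involution[OF params f_def])
    show "even (f x) \<and> f x \<noteq> n \<longleftrightarrow> even x \<and> x \<noteq> n" if "x \<in> X" for x
      using rev_zig_split(2)[OF params f_def] that by (simp add: X_def)
    show "f y < f x" if "x \<in> X" "y \<in> X" "x < y" "even x \<and> x \<noteq> n \<longleftrightarrow> even y \<and> y \<noteq> n" for x y
      using rev_zig_antimono[OF params f_def] that by (simp add: X_def)
    show "\<exists>y\<in>X. x < y \<and> p x < p y" if "x \<in> X" "even x \<and> x \<noteq> n" for x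
    proof (rule bexI[of _ "Suc x"])
      show "Suc x \<in> X" using that XD[OF that(1)] k by (auto simp: X_def)
      show "x < Suc x \<and> p x < p (Suc x)" using asc[of x] that XD[OF that(1)] by auto
    qed
    show "\<exists>y\<in>X. y < x \<and> p y < p x" if x: "x \<in> X" "\<not> (even x \<and> x \<noteq> n)" for x
    \<comment> \<open>A peak has the valley just before it as partner, unless that valley is the
      removed position \<open>k\<close>.\<close>
    proof (cases "odd x \<and> x \<noteq> Suc k")
      case True
      show ?thesis
      proof (rule bexI[of _ "x - 1"])
        have "x \<noteq> 2" using True by auto
        then show "x - 1 \<in> X" using True XD(4,6,7)[OF x(1)] by (auto simp: X_def)
        have "p (x - 1) < p (Suc (x - 1))"
          using True XD[OF x(1)] by (intro asc) (auto elim: oddE)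
        then show "x - 1 < x \<and> p (x - 1) < p x" using XD[OF x(1)] by auto
      qed
    next
      case False
      \<comment> \<open>Here \<open>x\<close> is \<open>n\<close>, or \<open>n\<close> is even and \<open>x\<close> is \<open>n - 1\<close>; position \<open>p 2\<close> carries the letter 2.\<close>
      have kn: "k \<noteq> n" using False x XD[OF x(1)] by auto
      then have m3: "m = 3" using m_eq by simp
      have x3: "3 \<le> p x \<and> (x = n \<or> x = n - 1)"
      proof (cases "x = n")
        case True
        then show ?thesis using ends m3 by simp
      next
        case n: False
        then have "x = Suc k" "x = n - 1" using False x XD[OF x(1)] k_ge by auto
        moreover from this have "p n < p (n - 1)"
          using desc[of "n - 1"] k by (cases n) auto
        ultimately show ?thesis using ends m3 by simp
      qed
      have "p 2 \<noteq> x" "p 2 \<noteq> n" using x3 ends m3 pD(2)[of 2] by auto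
      then have "p 2 < x" using x3 rng(2)[of 2] n by auto
      then show ?thesis using XD(3)[OF p2[OF kn]] x3 pD(2)[of 2] by (intro bexI[of _ "p 2"]) auto
    qed
    \<comment> \<open>A triple in \<open>X\<close> has to reach beyond \<open>k\<close> and start at
      2: position 3 carries \<open>n\<close> and cannot be \<open>a\<close> or \<open>b\<close>.
      Position \<open>n\<close> carries only 3, so \<open>c = k + 1\<close>. If \<open>b\<close> is
      even, replacing \<open>c\<close> by \<open>b + 1\<close> gives a triple before
      \<open>k\<close>; if \<open>b\<close> is odd, replacing \<open>a\<close> by
      \<open>b - 1\<close> gives one after \<open>m\<close>.\<close>
    show False if abc: "a \<in> X" "b \<in> X" "c \<in> X" "a < b" "b < c" "p a < p b" "p b < p c" for a b c
    proof -
      have ck: "k < c" using prefix[of a b c] abc XD[OF abc(1)] XD[OF abc(3)] by force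
      then have m3: "m = 3" and kn: "k \<noteq> n" using m_eq XD[OF abc(3)] by auto
      have "\<not> 3 < a" using suffix[of a b c] abc XD[OF abc(3)] m3 by force
      moreover have "p c \<le> n" using XD(6,7)[OF abc(3)] by (rule rng(2))
      then have "a \<noteq> m" "b \<noteq> m" using ends(4) abc by auto
      then have "a \<noteq> 3" "b \<noteq> 3" using m3 by auto
      ultimately have a: "a = 2" using XD[OF abc(1)] by auto
      have "p a \<ge> 2" using XD[OF abc(1)] rng(1)[of a] by auto
      then have "c \<noteq> n" using ends m3 abc by auto
      then have "c < n" using XD(7)[OF abc(3)] by simp
      then have c: "c = k + 1" "n = k + 2" using ck k_ge by linarith+
      have b: "3 < b" "b < k" using \<open>b \<noteq> 3\<close> abc a c XD[OF abc(2)] by auto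
      show False
      proof (cases "even b")
        case True
        then have "Suc b \<noteq> k" using k by auto
        then show False using prefix[of a b "Suc b"] asc[of b] True abc b r XD[OF abc(1)] by auto
      next
        case False
        then have "p (b - 1) < p (Suc (b - 1))" using b r by (intro asc) auto
        moreover have "b \<noteq> 4" using False by auto
        then have "m < b - 1" "b - 1 < b" "Suc (b - 1) = b" using b m3 by auto
        ultimately show False using suffix[of "b - 1" b c] abc XD(7)[OF abc(3)] by simp
      qed
    qed
  qed
  have "p x = f x" for x
  proof (cases "x \<in> X")
    case False
    then consider "x \<notin> {1..n}" | "x = 1" | "x = k" by (auto simp: X_def)
    then show ?thesis
    proof cases
      case 1
      then have "f x = x" unfolding f_def rev_zig_def by (intro if_P) auto
      then show ?thesis using 1 pD(7) by simp
    qed (use ends f_ends in auto)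
  qed (rule p_eq)
  then have "p = f" by auto
  with params show ?thesis using that f_def by blast
qed

text \<open>The parities are exchanged, and the same triples at \<open>k\<close> and
  \<open>m\<close> now force \<open>k = n - 1\<close> and \<open>m = 2\<close>. No position has to
  be removed: a triple would end at \<open>k\<close> or \<open>n\<close>, whose letters 1 and 2 are
  too small. Odd sizes are handled by \<open>revcomp\<close> instead.\<close>

lemma indecomposable_alternating_eq:
  assumes p: "p \<in> indecomposable False n" and n: "n \<ge> 2" "even n"
  shows "4 \<le> n" "p = zig n"
proof -
  note z = indecomposableD(1)[OF p]
  note pD = zigzagD[OF z]
  note no123 = indecomposable_no_123[OF z]
  define k where "k = p 1"
  define m where "m = p n"
  have ends: "p 1 = k" "p k = 1" "p n = m" "p m = n"
    by (simp_all add: k_def m_def pD(2))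
  have r: "k \<in> {1..n}" "m \<in> {1..n}"
    using n pD(6)[of 1] pD(6)[of n] by (auto simp: k_def m_def)
  have mk: "m < k" using indecomposable_ends[OF p n(1)] by (simp add: k_def m_def)
  have rng: "1 \<le> p i" "p i \<le> n" if "1 \<le> i" "i \<le> n" for i
    using that pD(6)[of i] by auto
  have desc: "p (Suc i) < p i" if "even i" "1 \<le> i" "i < n" for i
    using pD(5)[of i] that by auto
  have asc: "p i < p (Suc i)" if "odd i" "i < n" for i
  proof -
    have "p (Suc i) \<noteq> p i" using pD(4) by (simp add: inj_eq)
    then show ?thesis using pD(5)[of i] that by (cases "i = 0") auto
  qed
  have prefix: False if "1 \<le> a" "a < b" "b < c" "c < k" "p a < p b" "p b < p c" for a b c
    using no123(1)[of a b c] that r n by (auto simp: k_def)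
  have suffix: False if "m < a" "a < b" "b < c" "c \<le> n" "p a < p b" "p b < p c" for a b c
    using no123(2)[of a b c] that r n by (auto simp: m_def)
  have k: "odd k"
  proof
    assume k: "even k"
    show False
    proof (cases "k = n")
      case True
      then have "p (n - 1) < p (Suc (n - 1))" using k n by (intro asc) auto
      moreover have "1 \<le> p (n - 1)" using n by (intro rng(1)) auto
      ultimately show False using ends(2) True n by simp
    next
      case False
      then show False using desc[of k] ends(2) rng(1)[of "Suc k"] k r by auto
    qed
  qed
  have m: "even m"
  proof (rule ccontr)
    assume m: "odd m"
    have "m \<noteq> 1" using ends k n by auto
    then have m1: "m > 1" using r by auto
    then have "p (Suc (m - 1)) < p (m - 1)" using m r by (intro desc) auto
    moreover have "p (m - 1) \<le> n" using r m1 by (intro rng(2)) auto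
    ultimately show False using ends(4) m1 by simp
  qed
  have k_eq: "k = n - 1"
  proof (rule ccontr)
    assume "k \<noteq> n - 1"
    then have k3: "k + 3 \<le> n" using k r n by auto presburger
    have "p (k + 2) \<ge> 1" "p (k + 2) \<noteq> 1" "p (k + 2) < p (Suc (k + 2))"
      using k k3 rng(1)[of "k + 2"] asc[of "k + 2"] pD(2)[of "k + 2"] ends(1) by auto
    then show False
      using k3 suffix[of k "k + 2" "k + 3"] mk ends(2) by (simp add: numeral_3_eq_3)
  qed
  have m_eq: "m = 2"
  proof (rule ccontr)
    assume "m \<noteq> 2"
    moreover have "m \<noteq> 1" "m \<noteq> 3" using m by auto
    ultimately have m5: "m > 3" using r by auto
    have lt: "1 \<le> m - 3" "m - 3 < m - 2" "m - 2 < m" using m5 by linarith+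
    have "p (m - 3) < p (Suc (m - 3))" using m m5 r by (intro asc) auto
    moreover have "Suc (m - 3) = m - 2" using m5 by simp
    moreover have "p (m - 2) \<le> n" using m5 r by (intro rng(2)) auto
    moreover have "p (m - 2) \<noteq> n" using m5 pD(2)[of "m - 2"] ends(3) by auto
    ultimately show False using prefix[OF lt mk] ends(4) by simp
  qed
  show n4: "4 \<le> n" using m_eq k_eq mk by simp
  have p_eq: "p x = zig n x" if "x \<in> {1..n}" for x
  proof (rule no_123_unique[where p = p and r = "zig n" and x = x and L = odd and X = "{1..n}"])
    note f = zigzagD[OF indecomposableD(1)[OF zig_indecomposable[OF n(2) n4]]]
    show "finite {1..n}" "x \<in> {1..n}" using that by auto
    show "p (p i) = i" for i by (rule pD(2))
    show "p x \<in> {1..n}" if "x \<in> {1..n}" for x using that pD(6) by blast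
    show "zig n x \<in> {1..n}" if "x \<in> {1..n}" for x using that f(6) by blast
    show "zig n (zig n x) = x" for x by (rule f(2))
    show "odd (zig n x) \<longleftrightarrow> odd x" if "x \<in> {1..n}" for x
      using that n by (auto simp: zig_def)
    show "zig n y < zig n x" if "x \<in> {1..n}" "y \<in> {1..n}" "x < y" "odd x \<longleftrightarrow> odd y" for x y
      using that n by (auto simp: zig_def; presburger)
    show "\<exists>y\<in>{1..n}. x < y \<and> p x < p y" if "x \<in> {1..n}" "odd x" for x
      using that asc[of x] n by (intro bexI[of _ "Suc x"]) (auto simp: Suc_le_eq le_less)
    show "\<exists>y\<in>{1..n}. y < x \<and> p y < p x" if "x \<in> {1..n}" "\<not> odd x" for x
    proof (rule bexI[of _ "x - 1"])
      have "x \<ge> 2" using that by (auto elim: evenE)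
      moreover from this have "p (x - 1) < p (Suc (x - 1))" using that by (intro asc) auto
      ultimately show "x - 1 < x \<and> p (x - 1) < p x" "x - 1 \<in> {1..n}" using that by auto
    qed
    show False
      if abc: "a \<in> {1..n}" "b \<in> {1..n}" "c \<in> {1..n}" "a < b" "b < c" "p a < p b" "p b < p c"
      for a b c
    proof -
      have "k \<le> c" using prefix[of a b c] abc by force
      then have "c = n \<or> c = k" using k_eq abc(3) by auto
      then have "p c \<le> 2" using ends m_eq by auto
      then show False using abc rng(1)[of a] by auto
    qed
  qed
  show "p = zig n"
  proof
    show "p x = zig n x" for x
    proof (cases "x \<in> {1..n}")
      case False
      then have "zig n x = x" unfolding zig_def by (intro if_P) auto
      then show ?thesis using False pD(7) by simp
    qed (rule p_eq)
  qed
qed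

section \<open>Generating functions\<close>

text \<open>Sizes 0 and 1 fall outside the classification and contribute the identity. For even
  \<open>n \<ge> 6\<close> there are two words, told apart by their first letter.\<close>

lemma card_indecomposable_True:
  "card (indecomposable True n) =
     (if n = 0 \<or> n = 1 then 1 else if odd n then of_bool (5 \<le> n) else if 6 \<le> n then 2 else 1)"
proof (cases "n \<le> 1")
  case True
  have "indecomposable True n = {id}"
  proof (intro equalityI subsetI)
    fix p assume "p \<in> indecomposable True n"
    then have "p permutes {1..n}" by (intro zigzagD(1) indecomposableD(1))
    moreover have "{1..n} \<subseteq> {1}" using True by auto
    ultimately have "p permutes {1}" by (rule permutes_subset)
    then show "p \<in> {id}" by simp
  next
    fix p :: "nat \<Rightarrow> nat" assume "p \<in> {id}"
    moreover have "id \<in> zigzag True n"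
      by (rule zigzagI) (use True in \<open>auto simp: no_2341_def\<close>)
    ultimately show "p \<in> indecomposable True n"
      using True by (simp add: indecomposable_def)
  qed
  then show ?thesis using True by auto
next
  case False
  have eq: "indecomposable True n = {rev_zig n k m |k m. rev_zig_params n k m}"
  proof (intro equalityI subsetI)
    fix p assume "p \<in> indecomposable True n"
    then show "p \<in> {rev_zig n k m |k m. rev_zig_params n k m}"
      using False by (elim indecomposable_reverse_alternating_eq) auto
  qed (auto intro: rev_zig_indecomposable)
  show ?thesis
  proof (cases "odd n")
    case True
    then have "{rev_zig n k m |k m. rev_zig_params n k m} =
        (if 5 \<le> n then {rev_zig n (n - 1) 3} else {})"
      by (auto simp: rev_zig_params_def)
    then show ?thesis using eq True False by simp
  next
    case even: False
    have "rev_zig n n 1 \<noteq> rev_zig n (n - 2) 3" if "6 \<le> n"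
    proof
      assume "rev_zig n n 1 = rev_zig n (n - 2) 3"
      then have "rev_zig n n 1 1 = rev_zig n (n - 2) 3 1" by simp
      then show False using that by (simp add: rev_zig_def)
    qed
    moreover have "{rev_zig n k m |k m. rev_zig_params n k m} =
        (if 6 \<le> n then {rev_zig n n 1, rev_zig n (n - 2) 3} else {rev_zig n n 1})"
      using even False by (auto simp: rev_zig_params_def)
    ultimately show ?thesis using eq even False by simp
  qed
qed

lemma card_indecomposable_False:
  assumes "even n" "n \<ge> 2"
  shows "card (indecomposable False n) = of_bool (4 \<le> n)"
proof -
  have "indecomposable False n = (if 4 \<le> n then {zig n} else {})"
    using indecomposable_alternating_eq[OF _ assms(2,1)] zig_indecomposable[OF assms(1)] by auto
  then show ?thesis by simp
qed

lemma card_zigzag_0: "card (zigzag s 0) = 1"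
proof -
  have "zigzag s 0 = {id}"
  proof (intro equalityI subsetI)
    fix p assume "p \<in> zigzag s 0"
    then have "p permutes {1..0}" by (rule zigzagD(1))
    then show "p \<in> {id}" by simp
  qed (auto simp: no_2341_def intro!: zigzagI)
  then show ?thesis by simp
qed

section \<open>Products and convergence of power series\<close>

text \<open>The end terms are split off so that the middle sum runs over the cuts in
  \<open>{1..<n}\<close>, as in \<open>card_zigzag\<close>.\<close>

lemma fps_mult_nth_split:
  assumes "n \<ge> 1"
  shows "((f :: 'a :: comm_ring_1 fps) * g) $ n =
    f $ 0 * g $ n + (\<Sum>i\<in>{1..<n}. f $ i * g $ (n - i)) + f $ n * g $ 0"
proof -
  have "{0..n} = insert 0 (insert n {1..<n})" using assms by auto
  then show ?thesis using assms by (simp add: fps_mult_nth algebra_simps)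
qed

text \<open>Convergence is coefficientwise. Since \<open>g i \<ge> i\<close>, no term from index
  \<open>k + 1\<close> on affects the coefficient of degree \<open>k\<close>, which is therefore
  eventually constant.\<close>

lemma sums_fps_X_power:
  fixes F :: "rat fps"
  assumes g: "strict_mono g" and F: "\<And>k. F $ k = (if k \<in> range g then of_nat (a k) else 0)"
  shows "(\<lambda>n. of_nat (a (g n)) * fps_X ^ g n) sums F"
  unfolding sums_def
proof (rule tendsto_fpsI)
  fix k
  have coeff: "(of_nat c * fps_X ^ j :: rat fps) $ k = (if k = j then of_nat c else 0)" for c j
    by (simp flip: fps_of_nat)
  have partial: "(\<Sum>i<N. of_nat (a (g i)) * fps_X ^ g i :: rat fps) $ k = F $ k"
    if N: "k < N" for N
  proof (cases "k \<in> range g")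
    case True
    then obtain j where j: "k = g j" by auto
    then have "j < N" using N strict_mono_imp_increasing[OF g, of j] by simp
    have "(\<Sum>i<N. of_nat (a (g i)) * fps_X ^ g i :: rat fps) $ k =
        (\<Sum>i<N. if i = j then of_nat (a k) else 0)"
      unfolding fps_sum_nth coeff
      by (rule sum.cong) (use j g in \<open>auto simp: strict_mono_eq\<close>)
    then show ?thesis using \<open>j < N\<close> True F[of k] by simp
  next
    case False
    then have "(\<Sum>i<N. of_nat (a (g i)) * fps_X ^ g i :: rat fps) $ k = 0"
      unfolding fps_sum_nth coeff by (intro sum.neutral) auto
    then show ?thesis using False F[of k] by simp
  qed
  show "\<forall>\<^sub>F N in sequentially. (\<Sum>i<N. of_nat (a (g i)) * fps_X ^ g i :: rat fps) $ k = F $ k"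
    by (rule eventually_mono[OF eventually_gt_at_top[of k]]) (rule partial)
qed

theorem theorem11p3:
  fixes x :: "rat fps"
  assumes "x = fps_X"
  shows "((\<lambda>n. of_nat (card (AI_avoiding (2*n+1) [4,1,2,3] [2,3,4,1])) * x ^ (2*n+1))
           sums ((x^5 - x^3 + x) / (1 - 2*x^2 - x^6)))
         \<and> ((\<lambda>n. of_nat (card (RAI_avoiding (2*n+1) [4,1,2,3] [2,3,4,1])) * x ^ (2*n+1))
           sums ((x^5 - x^3 + x) / (1 - 2*x^2 - x^6)))
         \<and> ((\<lambda>n. of_nat (card (RAI_avoiding (2*n) [4,1,2,3] [2,3,4,1])) * x ^ (2*n))
           sums ((1 - x^2) / (1 - 2*x^2 - x^6)))
         \<and> ((\<lambda>n. of_nat (card (AI_avoiding (2*n) [4,1,2,3] [2,3,4,1])) * x ^ (2*n))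
           sums (1 + x^4 / (1 - x^2)
                   + (x^5 - x^3 + x)^2 / ((1 - 2*x^2 - x^6) * (1 - x^2))))"
proof -
  \<comment> \<open>\<open>E\<close> and \<open>U\<close> count the reverse alternating words of
    even and odd size, \<open>A\<close> the alternating ones of even size; \<open>IE\<close>,
    \<open>IU\<close>, \<open>IA\<close> count the indecomposable ones. Size 0 is left out of
    \<open>IE\<close> and \<open>IA\<close>, since a component is nonempty.\<close>
  define E where "E = Abs_fps (\<lambda>n. if even n then of_nat (card (zigzag True n)) else (0::rat))"
  define U where "U = Abs_fps (\<lambda>n. if odd n then of_nat (card (zigzag True n)) else (0::rat))"
  define A where "A = Abs_fps (\<lambda>n. if even n then of_nat (card (zigzag False n)) else (0::rat))"
  define IE where "IE = Abs_fps
      (\<lambda>n. if even n \<and> n > 0 then of_nat (card (indecomposable True n)) else (0::rat))"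
  define IU where "IU = Abs_fps
      (\<lambda>n. if odd n then of_nat (card (indecomposable True n)) else (0::rat))"
  define IA where "IA = Abs_fps
      (\<lambda>n. if even n \<and> n > 0 then of_nat (card (indecomposable False n)) else (0::rat))"
  have sum_filter: "(\<Sum>i\<in>{1..<n}. if P i then f i else 0) = (\<Sum>i | i \<in> {1..<n} \<and> P i. f i)"
    for n :: nat and P and f :: "nat \<Rightarrow> rat"
    by (simp add: sum.If_cases Int_def)
  have rec: "(of_nat (card (zigzag s n)) :: rat) = of_nat (card (indecomposable s n)) +
      (\<Sum>i\<in>{1..<n}. if even i \<longleftrightarrow> s
        then of_nat (card (zigzag s i)) * of_nat (card (indecomposable True (n - i))) else 0)"
    for s n
    unfolding sum_filter by (subst card_zigzag) simp
  \<comment> \<open>Reverse alternating words are cut at even positions, so the last component has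
    the parity of the whole word.\<close>
  have E: "E = 1 + E * IE"
  proof (rule fps_ext)
    fix n
    show "E $ n = (1 + E * IE) $ n"
    proof (cases "n = 0")
      case False
      then have "(E * IE) $ n = IE $ n + (\<Sum>i\<in>{1..<n}. E $ i * IE $ (n - i))"
        by (subst fps_mult_nth_split) (auto simp: E_def IE_def card_zigzag_0)
      moreover have "(\<Sum>i\<in>{1..<n}. E $ i * IE $ (n - i)) =
          (if even n then (\<Sum>i\<in>{1..<n}. if even i \<longleftrightarrow> True
             then of_nat (card (zigzag True i)) * of_nat (card (indecomposable True (n - i)))
             else 0) else 0)"
        by (auto simp: E_def IE_def intro!: sum.cong sum.neutral)
      ultimately show ?thesis using False rec[of True n] by (simp add: E_def IE_def)
    qed (simp add: E_def IE_def card_zigzag_0)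
  qed
  have U: "U = E * IU"
  proof (rule fps_ext)
    fix n
    show "U $ n = (E * IU) $ n"
    proof (cases "n = 0")
      case False
      then have "(E * IU) $ n = IU $ n + (\<Sum>i\<in>{1..<n}. E $ i * IU $ (n - i))"
        by (subst fps_mult_nth_split) (auto simp: E_def IU_def card_zigzag_0)
      moreover have "(\<Sum>i\<in>{1..<n}. E $ i * IU $ (n - i)) =
          (if odd n then (\<Sum>i\<in>{1..<n}. if even i \<longleftrightarrow> True
             then of_nat (card (zigzag True i)) * of_nat (card (indecomposable True (n - i)))
             else 0) else 0)"
        by (auto simp: E_def IU_def intro!: sum.cong sum.neutral)
      ultimately show ?thesis using False rec[of True n] by (simp add: U_def IU_def)
    qed (simp add: U_def IU_def)
  qed
  \<comment> \<open>Alternating words are cut at odd positions, so both parts of a decomposable word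
    of even size are odd; the first is counted by \<open>U\<close> through
    \<open>card_zigzag_odd\<close>.\<close>
  have A: "A = 1 + IA + U * IU"
  proof (rule fps_ext)
    fix n
    show "A $ n = (1 + IA + U * IU) $ n"
    proof (cases "n = 0")
      case False
      then have "(U * IU) $ n = (\<Sum>i\<in>{1..<n}. U $ i * IU $ (n - i))"
        by (subst fps_mult_nth_split) (auto simp: U_def IU_def)
      moreover have "(\<Sum>i\<in>{1..<n}. U $ i * IU $ (n - i)) =
          (if even n then (\<Sum>i\<in>{1..<n}. if even i \<longleftrightarrow> False
             then of_nat (card (zigzag False i)) * of_nat (card (indecomposable True (n - i)))
             else 0) else 0)"
        by (auto simp: U_def IU_def card_zigzag_odd intro!: sum.cong sum.neutral)
      ultimately show ?thesis using False rec[of False n] by (simp add: A_def IA_def)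
    qed (simp add: A_def IA_def U_def IU_def card_zigzag_0)
  qed
  \<comment> \<open>Multiplication by \<open>1 - x^2\<close> takes differences at distance two. The
    counts of indecomposables are eventually constant in each parity, so these differences form
    polynomials.\<close>
  have shift: "(f * (1 - x^2)) $ n = f $ n - (if n < 2 then 0 else f $ (n - 2))"
    for f :: "rat fps" and n
    unfolding assms by (simp add: right_diff_distrib fps_X_power_mult_right_nth)
  have IE: "IE * (1 - x^2) = x^2 + x^6"
    by (rule fps_ext, unfold shift, unfold assms)
      (auto simp: IE_def card_indecomposable_True; presburger)
  have IU: "IU * (1 - x^2) = x^5 - x^3 + x"
    by (rule fps_ext, unfold shift, unfold assms)
      (auto simp: IU_def card_indecomposable_True; presburger)
  have IA: "IA * (1 - x^2) = x^4"
    by (rule fps_ext, unfold shift, unfold assms)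
      (auto simp: IA_def card_indecomposable_False; presburger)
  have nz: "1 - x^2 \<noteq> 0" "1 - 2*x^2 - x^6 \<noteq> 0"
  proof -
    have "(1 - x^2) $ 0 = 1" "(1 - 2*x^2 - x^6) $ 0 = 1" using assms by simp_all
    then show "1 - x^2 \<noteq> 0" "1 - 2*x^2 - x^6 \<noteq> 0" by force+
  qed
  \<comment> \<open>The denominator is \<open>(1 - x^2) - (x^2 + x^6)\<close>, obtained from
    \<open>E = 1 + E * IE\<close> multiplied by \<open>1 - x^2\<close>.\<close>
  have E': "E * (1 - 2*x^2 - x^6) = 1 - x^2"
  proof -
    have "E * (1 - x^2) = (1 - x^2) + E * (IE * (1 - x^2))"
      by (subst E) (simp add: algebra_simps)
    then show ?thesis unfolding IE by (simp add: algebra_simps)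
  qed
  have U': "U * (1 - 2*x^2 - x^6) = x^5 - x^3 + x"
  proof -
    have "U * (1 - 2*x^2 - x^6) = (E * (1 - 2*x^2 - x^6)) * IU"
      by (simp add: U algebra_simps)
    then show ?thesis unfolding E' using IU by (simp add: mult.commute)
  qed
  have "E = (1 - x^2) / (1 - 2*x^2 - x^6)"
    unfolding E'[symmetric] using nz by simp
  moreover have "U = (x^5 - x^3 + x) / (1 - 2*x^2 - x^6)"
    unfolding U'[symmetric] using nz by simp
  moreover have "A = 1 + x^4 / (1 - x^2) + (x^5 - x^3 + x)^2 / ((1 - 2*x^2 - x^6) * (1 - x^2))"
  proof -
    have "x^4 / (1 - x^2) = IA" unfolding IA[symmetric] using nz by simp
    moreover have "(x^5 - x^3 + x)^2 = (U * IU) * ((1 - 2*x^2 - x^6) * (1 - x^2))"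
    proof -
      have "(x^5 - x^3 + x)^2 = (U * (1 - 2*x^2 - x^6)) * (IU * (1 - x^2))"
        unfolding U' IU by (simp add: power2_eq_square)
      then show ?thesis by (simp only: mult_ac)
    qed
    then have "(x^5 - x^3 + x)^2 / ((1 - 2*x^2 - x^6) * (1 - x^2)) = U * IU"
      using nz by simp
    ultimately show ?thesis using A by simp
  qed
  moreover have odds: "strict_mono (\<lambda>n::nat. 2 * n + 1)" and evens: "strict_mono (\<lambda>n::nat. 2 * n)"
    by (auto intro: strict_monoI)
  have odd_range: "k \<in> range (\<lambda>n::nat. 2 * n + 1) \<longleftrightarrow> odd k" for k
    by (auto elim: oddE)
  have even_range: "k \<in> range (\<lambda>n::nat. 2 * n) \<longleftrightarrow> even k" for k
    by (auto elim: evenE)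
  have "(\<lambda>n. of_nat (card (zigzag False (2*n+1))) * x ^ (2*n+1)) sums U"
    unfolding assms by (rule sums_fps_X_power[OF odds])
      (simp add: U_def odd_range card_zigzag_odd del: One_nat_def)
  moreover have "(\<lambda>n. of_nat (card (zigzag True (2*n+1))) * x ^ (2*n+1)) sums U"
    unfolding assms by (rule sums_fps_X_power[OF odds]) (simp add: U_def odd_range del: One_nat_def)
  moreover have "(\<lambda>n. of_nat (card (zigzag True (2*n))) * x ^ (2*n)) sums E"
    unfolding assms by (rule sums_fps_X_power[OF evens]) (simp add: E_def even_range)
  moreover have "(\<lambda>n. of_nat (card (zigzag False (2*n))) * x ^ (2*n)) sums A"
    unfolding assms by (rule sums_fps_X_power[OF evens]) (simp add: A_def even_range)
  ultimately show ?thesis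
    by (simp only: AI_avoiding_eq_zigzag RAI_avoiding_eq_zigzag)
qed

end
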